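(* Let $\mathcal{C}$ be a connected cyclic symmetric configuration $v_3$. Then the number of triangles contained in $\mathcal{C}$ is (i) $4v$ if $v=7$; (ii) $3v$ if $v=8$; (iii) $7v/3$ if $v=9$; (iv) one of $v$, $4v/3$ or $2v$ if $v\ge 10$.
   Context: A symmetric configuration $v_3$ is a finite incidence structure with $v$ points and $v$ blocks such that each block contains exactly $3$ points, each point is contained in exactly $3$ blocks, and any pair of distinct points is contained in at most one block. It is connected (indecomposable) if it is not the union of two configurations on disjoint point sets. A symmetric configuration $v_3$ is cyclic if it admits a cyclic automorphism of order $v$, so that it can be realised on the point set $\{0,1,\ldots,v-1\}$ with its set of blocks being a single orbit, under the mapping $i\mapsto i+1 \pmod v$, of a starter block $\{0,a,a+b\}$ with $a,b\in\{1,2,\ldots,v-2\}$ and $a+b\le v-1$. A triangle in a configuration is a set of three distinct blocks of the form $\{a,b,f\},\{a,c,e\},\{b,c,d\}$, where $a,b,c,d,e,f$ are six distinct points. *)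

theory Defs
  imports Complex_Main "HOL-Combinatorics.Orbits"
begin

text \<open>
  Two distinct blocks of a configuration share at most one point, so there are no repeated blocks
  and a block can be identified with the set of points on it.
\<close>

definition symmetric_configuration_3 :: "nat \<Rightarrow> 'a set \<Rightarrow> 'a set set \<Rightarrow> bool" where
  "symmetric_configuration_3 v V B \<longleftrightarrow>
     finite V \<and> card V = v \<and> card B = v \<and>
     (\<forall>b\<in>B. b \<subseteq> V \<and> card b = 3) \<and>
     (\<forall>x\<in>V. card {b \<in> B. x \<in> b} = 3) \<and>
     (\<forall>x\<in>V. \<forall>y\<in>V. x \<noteq> y \<longrightarrow> card {b \<in> B. x \<in> b \<and> y \<in> b} \<le> 1)"

text \<open>
  The two parts are required to be nonempty: the empty structure satisfies the conditions of a
  configuration with \<open>v = 0\<close>, and admitting it as a part would make everything decomposable.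
\<close>

definition connected_configuration_3 :: "'a set \<Rightarrow> 'a set set \<Rightarrow> bool" where
  "connected_configuration_3 V B \<longleftrightarrow>
     \<not> (\<exists>v1 v2 V1 V2 B1 B2.
          V1 \<noteq> {} \<and> V2 \<noteq> {} \<and> V1 \<inter> V2 = {} \<and>
          symmetric_configuration_3 v1 V1 B1 \<and> symmetric_configuration_3 v2 V2 B2 \<and>
          V = V1 \<union> V2 \<and> B = B1 \<union> B2)"

definition configuration_automorphism :: "('a \<Rightarrow> 'a) \<Rightarrow> 'a set \<Rightarrow> 'a set set \<Rightarrow> bool" where
  "configuration_automorphism \<sigma> V B \<longleftrightarrow> \<sigma> permutes V \<and> (\<lambda>b. \<sigma> ` b) ` B = B"

text \<open>
  A cyclic automorphism of order \<open>card V\<close> is one that permutes all the points in a single cycle.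
  Numbering the points along this cycle turns it into \<open>i \<mapsto> i + 1\<close> modulo \<open>card V\<close>. The blocks then
  form a single orbit: the only triples with a shorter orbit are the translates of
  \<open>{0, v/3, 2v/3}\<close>, and there are just \<open>v/3\<close> of these.
\<close>

definition cyclic_configuration :: "'a set \<Rightarrow> 'a set set \<Rightarrow> bool" where
  "cyclic_configuration V B \<longleftrightarrow>
     (\<exists>\<sigma>. configuration_automorphism \<sigma> V B \<and> cyclic_on \<sigma> V)"

definition triangles :: "'a set set \<Rightarrow> 'a set set set" where
  "triangles B =
     {T. T \<subseteq> B \<and>
         (\<exists>a b c d e f. distinct [a, b, c, d, e, f] \<and> T = {{a, b, f}, {a, c, e}, {b, c, d}})}"

end

theory Submission
  imports Defs
begin

text \<open>
  Number the points by the integers modulo \<open>v\<close>, so that the blocks are the translates of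
  \<open>{0, x, x + y}\<close>, and put \<open>z = - x - y\<close>. Two points are collinear iff their difference lies in
  \<open>{\<plusminus>x, \<plusminus>y, \<plusminus>z}\<close>, a set of six distinct residues. A triangle is determined by the three points in
  which its blocks meet, so triangles correspond to the 3-cliques of the collinearity graph that are
  not blocks. If \<open>M\<close> is the number of pairs of differences whose sum is again a difference, there are
  \<open>v M / 6\<close> cliques, hence \<open>v M / 6 - v\<close> triangles. Twelve such pairs come from \<open>x + y + z = 0\<close>; any
  others come from an element of order 3 among \<open>x, y, z\<close> (at most one if no element is twice another)
  or from a relation such as \<open>2 x = y\<close>. In the latter case the differences are
  \<open>\<plusminus>x, \<plusminus>2 x, \<plusminus>3 x\<close>, connectedness makes \<open>x\<close> a unit, and \<open>M\<close> depends on \<open>v\<close> only;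
  for \<open>v \<le> 9\<close> this case always occurs.
\<close>

section \<open>Triangles and cliques\<close>

definition collinear :: "'a set set \<Rightarrow> 'a \<Rightarrow> 'a \<Rightarrow> bool" where
  "collinear B a b \<longleftrightarrow> a \<noteq> b \<and> (\<exists>\<beta>\<in>B. a \<in> \<beta> \<and> b \<in> \<beta>)"

definition cliques_3 :: "('a \<Rightarrow> 'a \<Rightarrow> bool) \<Rightarrow> 'a set set" where
  "cliques_3 R = {{a, b, c} | a b c. R a b \<and> R b c \<and> R a c}"

text \<open>Irreflexivity makes the three points of a clique distinct and symmetry admits all six
  orderings of them, so each fibre of the map forgetting the order has six elements.\<close>

lemma card_ordered_cliques_3:
  assumes sym: "\<And>a b. R a b \<Longrightarrow> R b a" and irr: "\<And>a. \<not> R a a"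
    and fin: "finite V" and V: "\<And>a b. R a b \<Longrightarrow> a \<in> V"
  shows "card {(a, b, c). R a b \<and> R b c \<and> R a c} = 6 * card (cliques_3 R)"
proof -
  let ?O = "{(a, b, c). R a b \<and> R b c \<and> R a c}"
  let ?f = "\<lambda>(a, b, c). {a, b, c}"
  have finO: "finite ?O"
  proof (rule finite_subset)
    show "?O \<subseteq> V \<times> V \<times> V" using V sym by blast
    show "finite (V \<times> V \<times> V)" using fin by simp
  qed
  have img: "cliques_3 R = ?f ` ?O"
    unfolding cliques_3_def by (auto simp: image_iff)
  have fib: "card {t \<in> ?O. ?f t = K} = 6" if K6: "K \<in> cliques_3 R" for K
  proof -
    obtain a b c where K: "K = {a, b, c}" and R: "R a b" "R b c" "R a c"
      using K6 unfolding cliques_3_def by blast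
    have d: "a \<noteq> b" "b \<noteq> c" "a \<noteq> c" using R irr by auto
    have "{t \<in> ?O. ?f t = K} = {(a,b,c), (a,c,b), (b,a,c), (b,c,a), (c,a,b), (c,b,a)}" (is "?L = ?R")
    proof
      show "?R \<subseteq> ?L" using R sym K by auto
      show "?L \<subseteq> ?R"
      proof
        fix t assume "t \<in> ?L"
        then obtain a' b' c' where t: "t = (a', b', c')" "R a' b'" "R b' c'" "R a' c'" "{a', b', c'} = {a, b, c}"
          using K by auto
        have "a' \<noteq> b'" "b' \<noteq> c'" "a' \<noteq> c'" using t irr by auto
        moreover have "a' \<in> {a,b,c}" "b' \<in> {a,b,c}" "c' \<in> {a,b,c}" using t(5) by blast+
        ultimately show "t \<in> ?R" using t(1) by auto
      qed
    qed
    then show ?thesis using d by simp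
  qed
  have "card ?O = (\<Sum>K\<in>?f ` ?O. card {t \<in> ?O. ?f t = K})"
    using sum.image_gen[OF finO, of "\<lambda>_. 1::nat" ?f] by simp
  also have "\<dots> = (\<Sum>K\<in>cliques_3 R. 6)"
    unfolding img[symmetric] using fib by simp
  finally show ?thesis by simp
qed

lemma card_3_third:
  assumes "card \<beta> = 3" "a \<in> \<beta>" "b \<in> \<beta>" "a \<noteq> b"
  obtains f where "\<beta> = {a, b, f}" "f \<noteq> a" "f \<noteq> b"
proof -
  have "finite \<beta>" using assms(1) card.infinite by fastforce
  then have "card (\<beta> - {a, b}) = 1" using assms by simp
  then obtain f where "\<beta> - {a, b} = {f}" by (auto simp: card_1_singleton_iff)
  then have "\<beta> = {a, b, f}" "f \<noteq> a" "f \<noteq> b" using assms by auto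
  then show ?thesis by (rule that)
qed

text \<open>A triangle is sent to its three corners, the points lying on two of its blocks. The
  inverse sends a clique to the blocks joining its points; the clique must not be a block, for then
  the three joins would coincide.\<close>

lemma bij_betw_triangles:
  assumes card3: "\<And>\<beta>. \<beta> \<in> B \<Longrightarrow> card \<beta> = 3"
    and lin: "\<And>\<beta> \<gamma> a b. \<beta> \<in> B \<Longrightarrow> \<gamma> \<in> B \<Longrightarrow> a \<noteq> b \<Longrightarrow> a \<in> \<beta> \<Longrightarrow> b \<in> \<beta> \<Longrightarrow> a \<in> \<gamma> \<Longrightarrow> b \<in> \<gamma> \<Longrightarrow> \<beta> = \<gamma>"
  shows "bij_betw (\<lambda>T. {a. \<exists>\<beta>\<in>T. \<exists>\<gamma>\<in>T. \<beta> \<noteq> \<gamma> \<and> a \<in> \<beta> \<and> a \<in> \<gamma>})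
           (triangles B) (cliques_3 (collinear B) - B)"
proof -
  let ?g = "\<lambda>T. {a. \<exists>\<beta>\<in>T. \<exists>\<gamma>\<in>T. \<beta> \<noteq> \<gamma> \<and> a \<in> \<beta> \<and> a \<in> \<gamma>}"
  let ?h = "\<lambda>K. {\<beta>\<in>B. \<exists>a\<in>K. \<exists>b\<in>K. a \<noteq> b \<and> a \<in> \<beta> \<and> b \<in> \<beta>}"
  have g: "?g {{a, b, f}, {a, c, e}, {b, c, d}} = {a, b, c}"
    if D: "distinct [a, b, c, d, e, f]" for a b c d e f :: 'a
  proof -
    have "{a, b, f} \<noteq> {a, c, e}" "{a, b, f} \<noteq> {b, c, d}" "{a, c, e} \<noteq> {b, c, d}"
      using D by auto
    then show ?thesis using D by auto
  qed
  have h: "?h {a, b, c} = {{a, b, f}, {a, c, e}, {b, c, d}}"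
    if D: "distinct [a, b, c, d, e, f]" and B: "{a, b, f} \<in> B" "{a, c, e} \<in> B" "{b, c, d} \<in> B"
    for a b c d e f :: 'a
  proof
    show "?h {a, b, c} \<subseteq> {{a, b, f}, {a, c, e}, {b, c, d}}"
    proof
      fix \<beta> assume "\<beta> \<in> ?h {a, b, c}"
      then obtain u w where "\<beta> \<in> B" "u \<in> {a, b, c}" "w \<in> {a, b, c}" "u \<noteq> w" "u \<in> \<beta>" "w \<in> \<beta>" by blast
      then consider "a \<in> \<beta>" "b \<in> \<beta>" | "a \<in> \<beta>" "c \<in> \<beta>" | "b \<in> \<beta>" "c \<in> \<beta>"
        by blast
      moreover have "a \<noteq> b" "a \<noteq> c" "b \<noteq> c" using D by auto
      moreover note lin[OF \<open>\<beta> \<in> B\<close>] B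
      ultimately show "\<beta> \<in> {{a, b, f}, {a, c, e}, {b, c, d}}"
        by cases (simp_all add: insertI1)
    qed
    show "{{a, b, f}, {a, c, e}, {b, c, d}} \<subseteq> ?h {a, b, c}"
      using B D by auto
  qed
  have t1: "?g T \<in> cliques_3 (collinear B) - B \<and> ?h (?g T) = T" if T_tri: "T \<in> triangles B" for T
  proof -
    have TB: "T \<subseteq> B"
      and "\<exists>a b c d e f. distinct [a, b, c, d, e, f] \<and> T = {{a, b, f}, {a, c, e}, {b, c, d}}"
      using T_tri by (simp_all add: triangles_def)
    then obtain a b c d e f where D: "distinct [a, b, c, d, e, f]"
      and T: "T = {{a, b, f}, {a, c, e}, {b, c, d}}"
      by (elim exE conjE) (rule that)
    have B: "{a, b, f} \<in> B" "{a, c, e} \<in> B" "{b, c, d} \<in> B" using TB T by auto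
    have "collinear B a b" "collinear B b c" "collinear B a c"
      unfolding collinear_def using B D by auto
    then have "{a, b, c} \<in> cliques_3 (collinear B)"
      unfolding cliques_3_def by blast
    moreover have "{a, b, c} \<notin> B"
    proof
      assume "{a, b, c} \<in> B"
      then have "{a, b, c} = {a, b, f}"
        using lin[of "{a, b, c}" "{a, b, f}" a b] B D by auto
      then show False using D by auto
    qed
    ultimately show ?thesis unfolding T g[OF D] using h[OF D B] by blast
  qed
  have t2: "?h K \<in> triangles B \<and> ?g (?h K) = K" if K: "K \<in> cliques_3 (collinear B) - B" for K
  proof -
    obtain a b c where Kabc: "K = {a, b, c}"
      and col: "collinear B a b" "collinear B b c" "collinear B a c"
      using K unfolding cliques_3_def by blast
    have nB: "{a, b, c} \<notin> B" using K Kabc by blast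
    have ne: "a \<noteq> b" "b \<noteq> c" "a \<noteq> c" using col unfolding collinear_def by auto
    obtain f where f: "{a, b, f} \<in> B" "f \<noteq> a" "f \<noteq> b"
      using col(1) card3 ne unfolding collinear_def by (metis card_3_third)
    obtain e where e: "{a, c, e} \<in> B" "e \<noteq> a" "e \<noteq> c"
      using col(3) card3 ne unfolding collinear_def by (metis card_3_third)
    obtain d where d: "{b, c, d} \<in> B" "d \<noteq> b" "d \<noteq> c"
      using col(2) card3 ne unfolding collinear_def by (metis card_3_third)
    \<comment> \<open>A third point equal to the remaining corner would make
      \<open>{a, b, c}\<close> a block. Two equal third points would give two blocks sharing two
      points, hence equal blocks by \<open>lin\<close>.\<close>
    have fc: "f \<noteq> c" using f nB by auto
    have eb: "e \<noteq> b" using e nB by (auto simp: insert_commute)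
    have da: "d \<noteq> a" using d nB by (auto simp: insert_commute)
    have "f \<noteq> e" using lin[of "{a, b, f}" "{a, c, e}" a f] f e ne fc eb by auto
    moreover have "f \<noteq> d" using lin[of "{a, b, f}" "{b, c, d}" b f] f d ne fc da by auto
    moreover have "e \<noteq> d" using lin[of "{a, c, e}" "{b, c, d}" c e] e d ne eb da by auto
    ultimately have D: "distinct [a, b, c, d, e, f]"
      using ne f e d fc eb da by auto
    have "?h K = {{a, b, f}, {a, c, e}, {b, c, d}}"
      unfolding Kabc by (rule h[OF D f(1) e(1) d(1)])
    moreover have "{{a, b, f}, {a, c, e}, {b, c, d}} \<in> triangles B"
      unfolding triangles_def using D f(1) e(1) d(1) by blast
    ultimately show ?thesis using g[OF D] Kabc by simp
  qed
  show ?thesis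
  proof (rule bij_betw_byWitness[where f' = ?h])
    show "\<forall>T\<in>triangles B. ?h (?g T) = T"
      by (rule ballI) (rule conjunct2[OF t1])
    show "\<forall>K\<in>cliques_3 (collinear B) - B. ?g (?h K) = K"
      by (rule ballI) (rule conjunct2[OF t2])
    show "?g ` triangles B \<subseteq> cliques_3 (collinear B) - B"
      by (rule image_subsetI) (rule conjunct1[OF t1])
    show "?h ` (cliques_3 (collinear B) - B) \<subseteq> triangles B"
      by (rule image_subsetI) (rule conjunct1[OF t2])
  qed
qed

lemma block_in_cliques_3:
  assumes "\<beta> \<in> B" "card \<beta> = 3"
  shows "\<beta> \<in> cliques_3 (collinear B)"
proof -
  obtain a b c where abc: "\<beta> = {a, b, c}" "a \<noteq> b" "b \<noteq> c" "a \<noteq> c"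
    using assms(2) by (auto simp: card_3_iff)
  have "collinear B x y" if "x \<in> \<beta>" "y \<in> \<beta>" "x \<noteq> y" for x y
    using that assms(1) unfolding collinear_def by blast
  then have "collinear B a b" "collinear B b c" "collinear B a c"
    using abc by simp_all
  then show ?thesis
    unfolding cliques_3_def abc(1) by blast
qed

lemma configuration_linear:
  assumes cf: "symmetric_configuration_3 v V B"
    and "\<beta> \<in> B" "\<gamma> \<in> B" "a \<noteq> b" "a \<in> \<beta>" "b \<in> \<beta>" "a \<in> \<gamma>" "b \<in> \<gamma>"
  shows "\<beta> = \<gamma>"
proof -
  \<comment> \<open>\<open>card\<close> of an infinite set is 0, so the bound by 1 excludes a second
    block only once finiteness is known.\<close>
  have "finite B"
  proof (rule finite_subset)
    show "B \<subseteq> Pow V" "finite (Pow V)" using cf unfolding symmetric_configuration_3_def by auto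
  qed
  moreover have "card {\<beta> \<in> B. a \<in> \<beta> \<and> b \<in> \<beta>} \<le> 1"
    using assms unfolding symmetric_configuration_3_def by blast
  ultimately show ?thesis
    using assms(2-) by (auto simp: card_le_Suc0_iff_eq)
qed

text \<open>The corner sets of triangles are the cliques that are not blocks, and all
  \<open>v\<close> blocks are themselves cliques.\<close>

lemma card_triangles:
  assumes cf: "symmetric_configuration_3 v V B"
  shows "card (triangles B) + v = card (cliques_3 (collinear B))"
proof -
  have fin: "finite V" and cB: "card B = v" and B: "\<And>\<beta>. \<beta> \<in> B \<Longrightarrow> \<beta> \<subseteq> V \<and> card \<beta> = 3"
    using cf unfolding symmetric_configuration_3_def by auto
  have sub: "B \<subseteq> cliques_3 (collinear B)"
    using block_in_cliques_3 B by blast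
  have "cliques_3 (collinear B) \<subseteq> Pow V"
    using B unfolding cliques_3_def collinear_def by blast
  then have finK: "finite (cliques_3 (collinear B))"
    using fin finite_subset by blast
  have "card (triangles B) = card (cliques_3 (collinear B) - B)"
    using B configuration_linear[OF cf] by (intro bij_betw_same_card[OF bij_betw_triangles]) blast+
  also have "\<dots> = card (cliques_3 (collinear B)) - card B"
    using sub finK by (simp add: card_Diff_subset finite_subset)
  finally show ?thesis
    using card_mono[OF finK sub] cB by simp
qed

section \<open>Connectedness through block-closed point sets\<close>

text \<open>If \<open>U\<close> were a proper subset, every block would lie inside \<open>U\<close>
  or inside its complement, and both halves would be configurations, which connectedness rules
  out.\<close>

lemma closed_set_eq_points:
  assumes cf: "symmetric_configuration_3 v V B" and "connected_configuration_3 V B"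
    and U: "U \<subseteq> V" "U \<noteq> {}" and closed: "\<And>\<beta>. \<beta> \<in> B \<Longrightarrow> \<beta> \<inter> U \<noteq> {} \<Longrightarrow> \<beta> \<subseteq> U"
  shows "U = V"
proof (rule ccontr)
  have sub: "symmetric_configuration_3 (card W) W {\<beta> \<in> B. \<beta> \<subseteq> W}"
    if W: "W \<subseteq> V" and cl: "\<And>\<beta>. \<beta> \<in> B \<Longrightarrow> \<beta> \<inter> W \<noteq> {} \<Longrightarrow> \<beta> \<subseteq> W" for W
  proof -
    have fin: "finite V" and B: "\<And>\<beta>. \<beta> \<in> B \<Longrightarrow> \<beta> \<subseteq> V \<and> card \<beta> = 3"
      and deg: "\<And>a. a \<in> V \<Longrightarrow> card {\<beta> \<in> B. a \<in> \<beta>} = 3"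
      and le: "\<And>a b. a \<in> V \<Longrightarrow> b \<in> V \<Longrightarrow> a \<noteq> b \<Longrightarrow> card {\<beta> \<in> B. a \<in> \<beta> \<and> b \<in> \<beta>} \<le> 1"
      using cf unfolding symmetric_configuration_3_def by auto
    let ?C = "{\<beta> \<in> B. \<beta> \<subseteq> W}"
    have finW: "finite W" using W fin finite_subset by blast
    have finC: "finite ?C" using finW by (rule_tac finite_subset[of _ "Pow W"]) auto
    have e1: "{\<beta> \<in> ?C. a \<in> \<beta>} = {\<beta> \<in> B. a \<in> \<beta>}" if "a \<in> W" for a
      using cl that by blast
    have e2: "{\<beta> \<in> ?C. a \<in> \<beta> \<and> b \<in> \<beta>} = {\<beta> \<in> B. a \<in> \<beta> \<and> b \<in> \<beta>}" if "a \<in> W" for a b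
      using cl that by blast
    have "{a \<in> W. a \<in> \<beta>} = \<beta>" if "\<beta> \<in> ?C" for \<beta> using that by blast
    \<comment> \<open>Double counting of incidences: three blocks through each point and three
      points on each block give as many blocks as points in \<open>W\<close>.\<close>
    then have "(\<Sum>a\<in>W. card {\<beta> \<in> ?C. a \<in> \<beta>}) = 3 * card ?C"
      using B by (intro sum_multicount finW finC) auto
    moreover have "(\<Sum>a\<in>W. card {\<beta> \<in> ?C. a \<in> \<beta>}) = (\<Sum>a\<in>W. 3)"
      using deg W by (metis (no_types, lifting) e1 subsetD sum.cong)
    ultimately have "card ?C = card W" by simp
    then show ?thesis
      unfolding symmetric_configuration_3_def
      using finW B deg le W e1 e2 by (simp add: subset_iff)
  qed
  assume "U \<noteq> V"
  have BV: "\<beta> \<subseteq> V" "\<beta> \<noteq> {}" if "\<beta> \<in> B" for \<beta>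
    using cf that unfolding symmetric_configuration_3_def by auto
  have c1: "symmetric_configuration_3 (card U) U {\<beta> \<in> B. \<beta> \<subseteq> U}"
    by (rule sub[OF U(1) closed])
  have c2: "symmetric_configuration_3 (card (V - U)) (V - U) {\<beta> \<in> B. \<beta> \<subseteq> V - U}"
  proof (rule sub)
    fix \<beta> assume \<beta>: "\<beta> \<in> B" "\<beta> \<inter> (V - U) \<noteq> {}"
    then have "\<beta> \<inter> U = {}" using closed by blast
    then show "\<beta> \<subseteq> V - U" using BV \<beta>(1) by blast
  qed simp
  have c3: "B = {\<beta> \<in> B. \<beta> \<subseteq> U} \<union> {\<beta> \<in> B. \<beta> \<subseteq> V - U}"
    using closed BV by blast
  have c4: "V - U \<noteq> {}" "U \<inter> (V - U) = {}" "V = U \<union> (V - U)" using U \<open>U \<noteq> V\<close> by auto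
  have "\<exists>v1 v2 V1 V2 B1 B2. V1 \<noteq> {} \<and> V2 \<noteq> {} \<and> V1 \<inter> V2 = {} \<and>
      symmetric_configuration_3 v1 V1 B1 \<and> symmetric_configuration_3 v2 V2 B2 \<and>
      V = V1 \<union> V2 \<and> B = B1 \<union> B2"
    by (rule exI[of _ "card U"], rule exI[of _ "card (V - U)"], rule exI[of _ U],
        rule exI[of _ "V - U"], rule exI[of _ "{\<beta> \<in> B. \<beta> \<subseteq> U}"],
        rule exI[of _ "{\<beta> \<in> B. \<beta> \<subseteq> V - U}"], intro conjI U(2) c1 c2 c3 c4)
  then show False
    using assms(2) unfolding connected_configuration_3_def by (rule_tac notE)
qed

section \<open>Numbering the points by residues\<close>

text \<open>The numbering iterates \<open>\<sigma>\<close> from one point of the cycle and reduces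
  the exponent modulo the cycle length. Integer indices make negative translations
  available.\<close>

lemma cyclic_on_int_parametrization:
  assumes "finite V" "\<sigma> permutes V" "cyclic_on \<sigma> V"
  obtains p :: "int \<Rightarrow> 'a" where "\<And>i j. p i = p j \<longleftrightarrow> int (card V) dvd i - j"
    "range p = V" "\<And>i. \<sigma> (p i) = p (i + 1)"
proof -
  obtain x where x: "x \<in> V" "V = orbit \<sigma> x" using assms(3) unfolding cyclic_on_def by blast
  define n where "n = funpow_dist1 \<sigma> x x"
  have x_orb: "x \<in> orbit \<sigma> x" using x by simp
  have per: "(\<sigma> ^^ n) x = x" unfolding n_def by (rule funpow_dist1_prop[OF x_orb])
  have n0: "0 < n" unfolding n_def by simp
  have V: "V = (\<lambda>m. (\<sigma> ^^ m) x) ` {..<n}"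
    using x(2) orbit_altdef_bounded[OF per n0] by auto
  have inj: "inj_on (\<lambda>m. (\<sigma> ^^ m) x) {..<n}"
    using funpow_neq_less_funpow_dist1[OF x_orb] unfolding n_def inj_on_def by blast
  have cn: "card V = n" unfolding V using card_image[OF inj] by simp
  define p where "p = (\<lambda>i::int. (\<sigma> ^^ nat (i mod int n)) x)"
  have lt: "nat (i mod int n) < n" for i using n0 by (simp add: nat_less_iff)
  have eq: "p i = p j \<longleftrightarrow> int (card V) dvd i - j" for i j
  proof -
    have "p i = p j \<longleftrightarrow> nat (i mod int n) = nat (j mod int n)"
      unfolding p_def using inj_on_eq_iff[OF inj] lt by simp
    also have "\<dots> \<longleftrightarrow> i mod int n = j mod int n"
      using n0 by (simp add: eq_nat_nat_iff)
    finally show ?thesis by (simp add: cn mod_eq_dvd_iff)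
  qed
  have p_nat: "p (int m) = (\<sigma> ^^ m) x" for m
    unfolding p_def using funpow_mod_eq[OF per] by (simp flip: of_nat_mod)
  have range: "range p = V"
  proof
    show "range p \<subseteq> V" unfolding V p_def using lt by blast
    show "V \<subseteq> range p" unfolding V p_nat[symmetric] by blast
  qed
  have step: "\<sigma> (p i) = p (i + 1)" for i
  proof -
    define m where "m = nat (i mod int n)"
    have m: "int m = i mod int n" unfolding m_def using n0 by simp
    have "p i = p (int m)" unfolding eq m cn by (simp add: dvd_minus_mod)
    moreover have "p (i + 1) = p (int (Suc m))"
      unfolding eq cn by (simp add: m dvd_minus_mod)
    moreover have "\<sigma> (p (int m)) = p (int (Suc m))" unfolding p_nat by simp
    ultimately show ?thesis by simp
  qed
  show ?thesis by (rule that[OF eq range step])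
qed

text \<open>Supplying \<open>m\<close> and \<open>n\<close> by hand reduces each consequence of two
  congruences to a linear identity.\<close>

lemma dvd_linear_combination:
  fixes v a b c :: int
  assumes "v dvd a" "v dvd b" "c = m * a + n * b"
  shows "v dvd c"
  using assms by simp

text \<open>At most two nonzero residues are killed by 3, and they are opposite. In
  \<open>3 * a = v * k\<close> and \<open>3 * b = v * l\<close> neither \<open>k\<close> nor
  \<open>l\<close> is a multiple of 3, so they agree modulo 3 up to sign.\<close>

lemma dvd_triple_cases:
  fixes v a b :: int
  assumes "v \<noteq> 0" "v dvd 3 * a" "v dvd 3 * b" "\<not> v dvd a" "\<not> v dvd b"
  shows "v dvd b - a \<or> v dvd b + a"
proof -
  obtain k where k: "3 * a = v * k" using assms(2) by (elim dvdE)
  obtain l where l: "3 * b = v * l" using assms(3) by (elim dvdE)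
  have "\<not> 3 dvd k"
  proof
    assume "3 dvd k"
    then obtain m where "k = 3 * m" by (elim dvdE)
    then have "a = v * m" using k by simp
    then show False using assms(4) by simp
  qed
  moreover have "\<not> 3 dvd l"
  proof
    assume "3 dvd l"
    then obtain m where "l = 3 * m" by (elim dvdE)
    then have "b = v * m" using l by simp
    then show False using assms(5) by simp
  qed
  ultimately have "3 dvd l - k \<or> 3 dvd l + k" by presburger
  then show ?thesis
  proof
    assume "3 dvd l - k"
    then obtain m where m: "l - k = 3 * m" by (elim dvdE)
    have "3 * (b - a) = v * (l - k)" using k l by (simp add: algebra_simps)
    then have "b - a = v * m" unfolding m by simp
    then show ?thesis by simp
  next
    assume "3 dvd l + k"
    then obtain m where m: "l + k = 3 * m" by (elim dvdE)
    have "3 * (b + a) = v * (l + k)" using k l by (simp add: algebra_simps)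
    then have "b + a = v * m" unfolding m by simp
    then show ?thesis by simp
  qed
qed

section \<open>Counting differences modulo \<open>v\<close>\<close>

text \<open>Going round a block takes the steps \<open>x\<close>, \<open>y\<close> and
  \<open>z\<close>, the last one returning to the start. The incongruences together with
  \<open>sum_zero\<close> say that \<open>\<plusminus>x\<close>, \<open>\<plusminus>y\<close>,
  \<open>\<plusminus>z\<close> are six distinct nonzero residues; \<open>x = - y\<close>, for
  instance, would mean \<open>z = 0\<close>.\<close>

locale cyclic_starter =
  fixes v :: nat and p :: "int \<Rightarrow> 'a" and x y z :: int and B :: "'a set set"
  assumes v_pos: "0 < v"
    and p_eq_iff: "\<And>i j. p i = p j \<longleftrightarrow> int v dvd i - j"
    and sum_zero: "x + y + z = 0"
    and nonzero: "\<not> int v dvd x" "\<not> int v dvd y" "\<not> int v dvd z"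
    and double_nonzero: "\<not> int v dvd 2 * x" "\<not> int v dvd 2 * y" "\<not> int v dvd 2 * z"
    and diff_nonzero: "\<not> int v dvd x - y" "\<not> int v dvd y - z" "\<not> int v dvd z - x"
    and blocks: "B = range (\<lambda>i. {p i, p (i + x), p (i + x + y)})"
begin

text \<open>Integer representatives give exactly six numbers to sum over, while \<open>adj\<close>
  supplies the comparison modulo \<open>v\<close>.\<close>

definition diffs :: "int set" where "diffs = {x, - x, y, - y, z, - z}"

definition adj :: "int \<Rightarrow> bool" where "adj u \<longleftrightarrow> (\<exists>s\<in>diffs. int v dvd u - s)"

lemma adj_iff:
  "adj u \<longleftrightarrow> int v dvd u - x \<or> int v dvd u + x \<or> int v dvd u - y \<or> int v dvd u + y \<or>
    int v dvd u - z \<or> int v dvd u + z"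
  unfolding adj_def diffs_def by auto

lemma z_eq: "z = - x - y"
  using sum_zero by simp

lemma adj_minus: "adj (- u) \<longleftrightarrow> adj u"
proof -
  have e: "int v dvd - u - s \<longleftrightarrow> int v dvd u + s" "int v dvd - u + s \<longleftrightarrow> int v dvd u - s" for s
    using dvd_minus_iff[of "int v" "u + s"] dvd_minus_iff[of "int v" "u - s"] by simp_all
  show ?thesis unfolding adj_iff e by blast
qed

lemma adj_cong:
  assumes "int v dvd u - w"
  shows "adj u \<longleftrightarrow> adj w"
proof -
  have "int v dvd u - s \<longleftrightarrow> int v dvd w - s" for s
  proof
    assume "int v dvd u - s"
    then show "int v dvd w - s"
      by (rule dvd_linear_combination[OF assms, where m = "- 1" and n = 1]) simp
  next
    assume "int v dvd w - s"
    then show "int v dvd u - s"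
      by (rule dvd_linear_combination[OF assms, where m = 1 and n = 1]) simp
  qed
  then show ?thesis unfolding adj_def by simp
qed

lemma not_adj_0: "\<not> adj 0"
  using nonzero unfolding adj_iff by simp

text \<open>Relative to its start, a block has the positions \<open>0\<close>, \<open>x\<close> and
  \<open>x + y\<close>. Since \<open>x + y = - z\<close>, the differences of two distinct positions
  are the six elements of \<open>diffs\<close>.\<close>

lemma collinear_iff: "collinear B (p i) (p j) \<longleftrightarrow> adj (j - i)"
proof
  assume "collinear B (p i) (p j)"
  then obtain k where ne: "p i \<noteq> p j"
    and ij: "p i \<in> {p k, p (k + x), p (k + x + y)}" "p j \<in> {p k, p (k + x), p (k + x + y)}"
    unfolding collinear_def blocks by blast
  have "\<exists>a\<in>{0, x, x + y}. q = p (k + a)" if "q \<in> {p k, p (k + x), p (k + x + y)}" for q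
    using that by (auto simp: add.assoc)
  then obtain a b where a: "a \<in> {0, x, x + y}" "p i = p (k + a)"
    and b: "b \<in> {0, x, x + y}" "p j = p (k + b)"
    using ij by meson
  have "int v dvd (j - i) - (b - a)"
    using a(2) b(2) dvd_diff[of "int v" "j - (k + b)" "i - (k + a)"]
    unfolding p_eq_iff by (simp add: algebra_simps)
  moreover have "a \<noteq> b" using a b ne by auto
  then have "b - a \<in> diffs" using a(1) b(1) unfolding diffs_def unfolding z_eq by auto
  ultimately show "adj (j - i)" unfolding adj_def by blast
next
  have blk: "{p k, p (k + x), p (k + x + y)} \<in> B" for k unfolding blocks by blast
  \<comment> \<open>\<open>a\<close> and \<open>b\<close> are the positions of the two points in a
    common block, which therefore starts at \<open>i - a\<close>.\<close>
  have col: "collinear B (p i) (p j)"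
    if "a \<in> {0, x, x + y}" "b \<in> {0, x, x + y}" "int v dvd (j - i) - (b - a)" "\<not> int v dvd b - a" for a b
  proof -
    have pj: "p j = p (i - a + b)" unfolding p_eq_iff using that(3) by (simp add: algebra_simps)
    have "p i \<in> {p (i - a), p (i - a + x), p (i - a + x + y)}"
      using that(1) by (auto simp: algebra_simps)
    moreover have "p j \<in> {p (i - a), p (i - a + x), p (i - a + x + y)}"
      unfolding pj using that(2) by (auto simp: algebra_simps)
    moreover have "p i \<noteq> p j"
    proof
      assume "p i = p j"
      then have "int v dvd i - j" unfolding p_eq_iff .
      then have "int v dvd - ((i - j) + ((j - i) - (b - a)))"
        using that(3) by (intro iffD2[OF dvd_minus_iff] dvd_add)
      then show False using that(4) by simp
    qed
    ultimately show ?thesis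
      unfolding collinear_def by (intro conjI bexI[OF _ blk[of "i - a"]])
  qed
  have nz: "\<not> int v dvd - x" "\<not> int v dvd - y" "\<not> int v dvd x + y" "\<not> int v dvd - x - y"
    using nonzero dvd_minus_iff[of "int v" "x + y"] unfolding z_eq by simp_all
  assume "adj (j - i)"
  then show "collinear B (p i) (p j)"
    unfolding adj_def diffs_def unfolding z_eq
    using col[of 0 x] col[of x 0] col[of x "x + y"] col[of "x + y" x]
      col[of "x + y" 0] col[of 0 "x + y"] nonzero nz
    by (auto simp: add.commute[of y x])
qed

text \<open>Two different representatives differ, up to sign, by a double, a difference or a sum of
  two of \<open>x\<close>, \<open>y\<close>, \<open>z\<close>. A sum of two is minus the third, so
  none of these vanishes modulo \<open>v\<close>.\<close>

lemma diffs_inj: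
  assumes "s \<in> diffs" "t \<in> diffs" "int v dvd s - t"
  shows "s = t"
proof -
  have d: "int v dvd t - s" using assms(3) by (simp add: dvd_diff_commute)
  have n: "\<not> int v dvd x + y" "\<not> int v dvd y + z" "\<not> int v dvd z + x"
    "\<not> int v dvd y + x" "\<not> int v dvd z + y" "\<not> int v dvd x + z"
  proof -
    have e: "x + y = - z" "y + z = - x" "z + x = - y" "y + x = - z" "z + y = - x" "x + z = - y"
      using sum_zero by auto
    show "\<not> int v dvd x + y" "\<not> int v dvd y + z" "\<not> int v dvd z + x"
      "\<not> int v dvd y + x" "\<not> int v dvd z + y" "\<not> int v dvd x + z"
      unfolding e dvd_minus_iff by (fact nonzero)+
  qed
  have m: "\<not> int v dvd y - x" "\<not> int v dvd z - y" "\<not> int v dvd x - z"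
    using diff_nonzero by (simp_all add: dvd_diff_commute)
  show ?thesis
    using assms(1,2) unfolding diffs_def
    by (elim insertE emptyE; hypsubst)
      (use assms(3) d n m diff_nonzero double_nonzero in simp_all)
qed

text \<open>An ordered clique is a starting point with two steps \<open>s\<close> and
  \<open>t\<close> from \<open>diffs\<close>; the remaining collinearity is the condition
  \<open>adj (s + t)\<close>. There are \<open>v\<close> starting points, and each clique has six
  orderings.\<close>

lemma card_cliques_3:
  "6 * card (cliques_3 (collinear B)) = v * card {(s, t) \<in> diffs \<times> diffs. adj (s + t)}"
proof -
  let ?O = "{(a, b, c). collinear B a b \<and> collinear B b c \<and> collinear B a c}"
  let ?M = "{(s, t) \<in> diffs \<times> diffs. adj (s + t)}"
  let ?f = "\<lambda>(i, s, t). (p i, p (i + s), p (i + s + t))"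
  \<comment> \<open>Indices in \<open>{0..<int v}\<close> name each point exactly once.\<close>
  have rep: "\<exists>i\<in>{0..<int v}. p j = p i" for j
    using v_pos by (intro bexI[of _ "j mod int v"]) (simp_all add: p_eq_iff)
  have fin: "finite (p ` {0..<int v})" by simp
  have ran: "range p = p ` {0..<int v}" using rep by blast
  have in_ran: "a \<in> range p" if "collinear B a b" for a b
    using that unfolding collinear_def blocks by auto
  have "6 * card (cliques_3 (collinear B)) = card ?O"
    by (rule card_ordered_cliques_3[symmetric, OF _ _ fin])
      (use in_ran ran in \<open>auto simp: collinear_def\<close>)
  also have "\<dots> = card ({0..<int v} \<times> ?M)"
  proof (rule bij_betw_same_card[symmetric])
    show "bij_betw ?f ({0..<int v} \<times> ?M) ?O"
      unfolding bij_betw_def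
    proof
      show "inj_on ?f ({0..<int v} \<times> ?M)"
      proof (rule inj_onI)
        fix q q' assume q: "q \<in> {0..<int v} \<times> ?M" "q' \<in> {0..<int v} \<times> ?M" "?f q = ?f q'"
        obtain i s t i' s' t' where e: "q = (i, s, t)" "q' = (i', s', t')" by (metis prod_cases3)
        have "int v dvd i - i'" using q(3) unfolding e by (simp add: p_eq_iff)
        moreover have "0 \<le> i" "i < int v" "0 \<le> i'" "i' < int v" using q unfolding e by auto
        ultimately have i: "i = i'"
          using zdvd_imp_le[of "int v" "i - i'"] zdvd_imp_le[of "int v" "i' - i"] by (smt (verit) dvd_diff_commute)
        have s: "s = s'" using q unfolding e i by (intro diffs_inj) (auto simp: p_eq_iff)
        have t: "t = t'" using q unfolding e i s by (intro diffs_inj) (auto simp: p_eq_iff)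
        show "q = q'" unfolding e i s t by simp
      qed
      show "?f ` ({0..<int v} \<times> ?M) = ?O"
      proof
        have "adj s" if "s \<in> diffs" for s unfolding adj_def using that by (intro bexI[of _ s]) simp_all
        then show "?f ` ({0..<int v} \<times> ?M) \<subseteq> ?O" by (auto simp: collinear_iff)
        show "?O \<subseteq> ?f ` ({0..<int v} \<times> ?M)"
        proof
          fix q assume "q \<in> ?O"
          then obtain a b c where q: "q = (a, b, c)" and
            col: "collinear B a b" "collinear B b c" "collinear B a c" by auto
          obtain i where i: "i \<in> {0..<int v}" "a = p i" using in_ran[OF col(1)] ran by blast
          have bc: "b \<in> range p" "c \<in> range p" using in_ran[OF col(2)] in_ran[of c b] col(2)
            unfolding collinear_def by blast+
          then obtain j k where jk: "b = p j" "c = p k" by blast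
          have "adj (j - i)" "adj (k - j)" using col unfolding i jk collinear_iff by auto
          then obtain s t where s: "s \<in> diffs" "int v dvd j - i - s" and t: "t \<in> diffs" "int v dvd k - j - t"
            unfolding adj_def by blast
          have b: "b = p (i + s)" unfolding jk p_eq_iff using s(2) by (simp add: algebra_simps)
          have c: "c = p (i + s + t)" unfolding jk p_eq_iff
            using dvd_add[OF s(2) t(2)] by (simp add: algebra_simps)
          have "adj (s + t)" using col(3) unfolding i c collinear_iff by (simp add: algebra_simps)
          then show "q \<in> ?f ` ({0..<int v} \<times> ?M)"
            using i s t unfolding q i b c by (intro image_eqI[of _ _ "(i, s, t)"]) auto
        qed
      qed
    qed
  qed
  also have "\<dots> = v * card ?M" by (simp add: card_cartesian_product)
  finally show ?thesis .
qed

section \<open>Pairs of differences whose sum is a difference\<close>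

abbreviation adj01 :: "int \<Rightarrow> nat" where "adj01 u \<equiv> of_bool (adj u)"

lemma adj01_minus: "adj01 (- u) = adj01 u"
  by (simp add: adj_minus)

lemma distinct_diffs: "distinct [x, - x, y, - y, z, - z]"
proof -
  have "x \<noteq> 0" "y \<noteq> 0" "z \<noteq> 0" "x \<noteq> y" "y \<noteq> z" "z \<noteq> x"
    using nonzero diff_nonzero by auto
  then show ?thesis using sum_zero by auto
qed

lemma sum_diffs: "sum f diffs = f x + f (- x) + f y + f (- y) + f z + f (- z)" for f :: "int \<Rightarrow> nat"
proof -
  have "diffs = set [x, - x, y, - y, z, - z]" unfolding diffs_def by simp
  then show ?thesis using sum.distinct_set_conv_list[OF distinct_diffs, of f] by (simp add: add.assoc)
qed

lemma finite_diffs: "finite diffs"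
  unfolding diffs_def by simp

lemma adj_diffs: "s \<in> diffs \<Longrightarrow> adj s"
  unfolding adj_def by (intro bexI[of _ s]) simp_all

definition diff_sums :: nat where "diff_sums = card {(s, t) \<in> diffs \<times> diffs. adj (s + t)}"

text \<open>Negating both entries of a pair preserves the condition, so it suffices to take
  \<open>s\<close> among \<open>x\<close>, \<open>y\<close>, \<open>z\<close> and double. Each such
  \<open>s\<close> has two sums that are minus the third element, which accounts for 12. A double
  arises once per half, and \<open>x - y\<close> arises there twice up to sign, from
  \<open>s = x\<close> and from \<open>s = y\<close>.\<close>

lemma diff_sums_eq:
  "diff_sums = 12 + 2 * (adj01 (2 * x) + adj01 (2 * y) + adj01 (2 * z)) + 4 * (adj01 (x - y) + adj01 (y - z) + adj01 (z - x))"
proof -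
  define f where "f s = (\<Sum>t\<in>diffs. adj01 (s + t))" for s
  have "{(s, t) \<in> diffs \<times> diffs. adj (s + t)} = (SIGMA s:diffs. diffs \<inter> {t. adj (s + t)})" by auto
  then have Ms: "diff_sums = (\<Sum>s\<in>diffs. f s)"
    unfolding diff_sums_def f_def using finite_diffs by (simp add: sum_of_bool_eq)
  have f: "f s = adj01 (s + x) + adj01 (s - x) + adj01 (s + y) + adj01 (s - y) + adj01 (s + z) + adj01 (s - z)" for s
    unfolding f_def sum_diffs by simp
  have fm: "f (- s) = f s" for s
  proof -
    have "adj01 (- s + t) = adj01 (s - t)" "adj01 (- s - t) = adj01 (s + t)" for t
      using adj01_minus[of "s - t"] adj01_minus[of "s + t"] by simp_all
    then show ?thesis unfolding f by simp
  qed
  have diff_sums: "diff_sums = 2 * (f x + f y + f z)" unfolding Ms sum_diffs fm by simp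
  have 1: "x + y = - z" "y + z = - x" "z + x = - y" "y + x = - z" "z + y = - x" "x + z = - y"
    using sum_zero by auto
  have 2: "adj01 (- x) = 1" "adj01 (- y) = 1" "adj01 (- z) = 1"
    using adj_diffs unfolding diffs_def by simp_all
  have 3: "adj01 (y - x) = adj01 (x - y)" "adj01 (z - y) = adj01 (y - z)" "adj01 (x - z) = adj01 (z - x)"
    using adj01_minus[of "x - y"] adj01_minus[of "y - z"] adj01_minus[of "z - x"] by simp_all
  have 4: "adj01 0 = 0" using not_adj_0 by simp
  show ?thesis
    unfolding diff_sums f 1 2 3 by (simp add: 4 mult_2[symmetric])
qed

text \<open>By \<open>x + y + z = 0\<close>, three of the six congruences for \<open>2 * x\<close>
  reduce to \<open>x\<close>, \<open>x - y\<close> or \<open>z - x\<close> vanishing and are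
  excluded.\<close>

lemma adj_double:
  "adj (2 * x) \<longleftrightarrow> int v dvd 3 * x \<or> int v dvd 2 * x - y \<or> int v dvd 2 * x - z"
  "adj (2 * y) \<longleftrightarrow> int v dvd 3 * y \<or> int v dvd 2 * y - z \<or> int v dvd 2 * y - x"
  "adj (2 * z) \<longleftrightarrow> int v dvd 3 * z \<or> int v dvd 2 * z - x \<or> int v dvd 2 * z - y"
proof -
  have "2 * x - x = x" "2 * x + x = 3 * x" "2 * x + y = - (z - x)" "2 * x + z = x - y"
    "2 * y - y = y" "2 * y + y = 3 * y" "2 * y + z = - (x - y)" "2 * y + x = y - z"
    "2 * z - z = z" "2 * z + z = 3 * z" "2 * z + x = - (y - z)" "2 * z + y = z - x"
    using sum_zero by auto
  then show "adj (2 * x) \<longleftrightarrow> int v dvd 3 * x \<or> int v dvd 2 * x - y \<or> int v dvd 2 * x - z"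
  "adj (2 * y) \<longleftrightarrow> int v dvd 3 * y \<or> int v dvd 2 * y - z \<or> int v dvd 2 * y - x"
  "adj (2 * z) \<longleftrightarrow> int v dvd 3 * z \<or> int v dvd 2 * z - x \<or> int v dvd 2 * z - y"
    unfolding adj_iff using nonzero diff_nonzero by (simp_all only: dvd_minus_iff) blast+
qed

text \<open>Four of the six congruences for \<open>x - y\<close> would make \<open>x\<close>,
  \<open>y\<close>, \<open>2 * x\<close> or \<open>2 * y\<close> vanish.\<close>

lemma adj_diff:
  "adj (x - y) \<longleftrightarrow> int v dvd 2 * x - y \<or> int v dvd 2 * y - x"
  "adj (y - z) \<longleftrightarrow> int v dvd 2 * y - z \<or> int v dvd 2 * z - y"
  "adj (z - x) \<longleftrightarrow> int v dvd 2 * z - x \<or> int v dvd 2 * x - z"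
proof -
  have "x - y - x = - y" "x - y + x = 2 * x - y" "x - y - y = - (2 * y - x)" "x - y + y = x"
    "x - y - z = 2 * x" "x - y + z = - (2 * y)"
    "y - z - y = - z" "y - z + y = 2 * y - z" "y - z - z = - (2 * z - y)" "y - z + z = y"
    "y - z - x = 2 * y" "y - z + x = - (2 * z)"
    "z - x - z = - x" "z - x + z = 2 * z - x" "z - x - x = - (2 * x - z)" "z - x + x = z"
    "z - x - y = 2 * z" "z - x + y = - (2 * x)"
    using sum_zero by auto
  then show "adj (x - y) \<longleftrightarrow> int v dvd 2 * x - y \<or> int v dvd 2 * y - x"
  "adj (y - z) \<longleftrightarrow> int v dvd 2 * y - z \<or> int v dvd 2 * z - y"
  "adj (z - x) \<longleftrightarrow> int v dvd 2 * z - x \<or> int v dvd 2 * x - z"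
    unfolding adj_iff using nonzero double_nonzero by (simp_all only: dvd_minus_iff) blast+
qed

text \<open>Relations \<open>2 x = - y\<close> need not be listed: they would give \<open>z = x\<close>.\<close>

definition doubling :: bool where
  "doubling \<longleftrightarrow> int v dvd 2 * x - y \<or> int v dvd 2 * x - z \<or> int v dvd 2 * y - z \<or>
     int v dvd 2 * y - x \<or> int v dvd 2 * z - x \<or> int v dvd 2 * z - y"

text \<open>Without a doubling only terms for elements of order 3 survive in
  \<open>diff_sums_eq\<close>. Two such elements would be equal or opposite by
  \<open>dvd_triple_cases\<close>; equality is excluded, and opposite elements make the third one
  vanish.\<close>

lemma diff_sums_not_doubling:
  assumes "\<not> doubling"
  shows "diff_sums \<in> {12, 14}"
proof -
  have D2: "adj (2 * x) \<longleftrightarrow> int v dvd 3 * x" "adj (2 * y) \<longleftrightarrow> int v dvd 3 * y" "adj (2 * z) \<longleftrightarrow> int v dvd 3 * z"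
    "\<not> adj (x - y)" "\<not> adj (y - z)" "\<not> adj (z - x)"
    using assms unfolding adj_double adj_diff doubling_def by auto
  have v0: "int v \<noteq> 0" using v_pos by simp
  have "\<not> (int v dvd 3 * a \<and> int v dvd 3 * b)"
    if "\<not> int v dvd a" "\<not> int v dvd b" "\<not> int v dvd a - b" "\<not> int v dvd c" "a + b + c = 0" for a b c
  proof
    assume A: "int v dvd 3 * a \<and> int v dvd 3 * b"
    have e: "b + a = - c" using that(5) by simp
    show False
      using dvd_triple_cases[OF v0 _ _ that(1,2)] A that(3,4) unfolding e
      by (simp add: dvd_diff_commute)
  qed
  from this[of x y z] this[of y z x] this[of z x y]
  have "\<not> (int v dvd 3 * x \<and> int v dvd 3 * y)" "\<not> (int v dvd 3 * y \<and> int v dvd 3 * z)"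
    "\<not> (int v dvd 3 * z \<and> int v dvd 3 * x)"
    using nonzero diff_nonzero sum_zero by (simp_all add: algebra_simps)
  then show ?thesis unfolding diff_sums_eq using D2 by (auto simp: of_bool_def)
qed

text \<open>For 7 the differences are all nonzero residues, and for 8 all but 4. In each case this
  is a finite check over residues \<open>x\<close> and \<open>y\<close>, left to Presburger
  arithmetic once \<open>z\<close> is eliminated and \<open>v\<close> is a numeral.\<close>

lemma doubling_small:
  assumes "v \<in> {7, 8, 9}"
  shows doubling
proof -
  note facts = nonzero[unfolded z_eq] double_nonzero[unfolded z_eq] diff_nonzero[unfolded z_eq]
  from assms consider "v = 7" | "v = 8" | "v = 9" by blast
  then show ?thesis
  proof cases
    case 1
    show ?thesis using facts unfolding doubling_def unfolding z_eq 1 of_nat_numeral by presburger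
  next
    case 2
    show ?thesis using facts unfolding doubling_def unfolding z_eq 2 of_nat_numeral by presburger
  next
    case 3
    show ?thesis using facts unfolding doubling_def unfolding z_eq 3 of_nat_numeral by presburger
  qed
qed

section \<open>Differences that are multiples of one element\<close>

text \<open>If \<open>s\<close> is the element whose double is another one, the three elements are
  congruent to \<open>s\<close>, \<open>2 * s\<close> and \<open>- 3 * s\<close>.\<close>

lemma doubling_scale:
  assumes doubling
  obtains s where "diff_sums = 12 + 2 * (adj01 (2 * s) + adj01 (4 * s) + adj01 (6 * s)) + 4 * (adj01 s + adj01 (5 * s) + adj01 (4 * s))"
    "\<And>u. adj u \<longleftrightarrow> int v dvd u - s \<or> int v dvd u + s \<or> int v dvd u - 2 * s \<or> int v dvd u + 2 * s \<or>
      int v dvd u - 3 * s \<or> int v dvd u + 3 * s"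
proof -
  note result = that
  \<comment> \<open>Stated for any arrangement \<open>s\<close>, \<open>t\<close>, \<open>w\<close>
    of the three elements, so that each of the six relations in \<open>doubling\<close> is one
    instance.\<close>
  have main: thesis
    if sum: "s + t + w = 0" and st: "int v dvd 2 * s - t"
      and diff_sums: "diff_sums = 12 + 2 * (adj01 (2 * s) + adj01 (2 * t) + adj01 (2 * w)) + 4 * (adj01 (s - t) + adj01 (t - w) + adj01 (w - s))"
      and adj: "\<And>u. adj u \<longleftrightarrow> int v dvd u - s \<or> int v dvd u + s \<or> int v dvd u - t \<or> int v dvd u + t \<or>
        int v dvd u - w \<or> int v dvd u + w" for s t w
  proof -
    have w: "w = - s - t" using sum by simp
    have eq: "int v dvd a \<longleftrightarrow> int v dvd b" if "a - b = 2 * s - t \<or> a - b = - (2 * s - t)" for a b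
    proof -
      have "int v dvd a - b" using that st by (metis dvd_minus_iff)
      then show ?thesis by (metis dvd_add_right_iff diff_add_cancel dvd_add_right_iff)
    qed
    have c: "adj01 a = adj01 b" if "a - b = n * (2 * s - t)" for a b n
      using adj_cong[of a b] st that by simp
    \<comment> \<open>The instantiated number is the multiple of \<open>2 * s - t\<close> by which
      the two arguments differ.\<close>
    have "adj01 (2 * t) = adj01 (4 * s)" by (rule c[of _ _ "- 2"]) simp
    moreover have "adj01 (2 * w) = adj01 (- (6 * s))" unfolding w by (rule c[of _ _ 2]) simp
    moreover have "adj01 (s - t) = adj01 (- s)" by (rule c[of _ _ 1]) simp
    moreover have "adj01 (t - w) = adj01 (5 * s)" unfolding w by (rule c[of _ _ "- 2"]) simp
    moreover have "adj01 (w - s) = adj01 (- (4 * s))" unfolding w by (rule c[of _ _ 1]) simp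
    ultimately have "diff_sums = 12 + 2 * (adj01 (2 * s) + adj01 (4 * s) + adj01 (6 * s)) + 4 * (adj01 s + adj01 (5 * s) + adj01 (4 * s))"
      unfolding diff_sums by (simp only: adj01_minus)
    moreover have "adj u \<longleftrightarrow> int v dvd u - s \<or> int v dvd u + s \<or> int v dvd u - 2 * s \<or> int v dvd u + 2 * s \<or>
      int v dvd u - 3 * s \<or> int v dvd u + 3 * s" for u
    proof -
      have "int v dvd u - t \<longleftrightarrow> int v dvd u - 2 * s" by (rule eq) simp
      moreover have "int v dvd u + t \<longleftrightarrow> int v dvd u + 2 * s" by (rule eq) simp
      moreover have "int v dvd u - w \<longleftrightarrow> int v dvd u + 3 * s" unfolding w by (rule eq) simp
      moreover have "int v dvd u + w \<longleftrightarrow> int v dvd u - 3 * s" unfolding w by (rule eq) simp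
      ultimately show ?thesis unfolding adj by blast
    qed
    ultimately show thesis by (rule result)
  qed
  have flip: "adj01 (y - x) = adj01 (x - y)" "adj01 (z - y) = adj01 (y - z)" "adj01 (x - z) = adj01 (z - x)"
    using adj01_minus[of "x - y"] adj01_minus[of "y - z"] adj01_minus[of "z - x"] by simp_all
  from assms show thesis
    unfolding doubling_def
  proof (elim disjE)
    assume A: "int v dvd 2 * x - y"
    show thesis
      by (rule main[of x y z, OF _ A])
        (use sum_zero in simp, simp add: diff_sums_eq flip, auto simp: adj_iff)
  next
    assume A: "int v dvd 2 * x - z"
    show thesis
      by (rule main[of x z y, OF _ A])
        (use sum_zero in simp, simp add: diff_sums_eq flip, auto simp: adj_iff)
  next
    assume A: "int v dvd 2 * y - z"
    show thesis
      by (rule main[of y z x, OF _ A])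
        (use sum_zero in simp, simp add: diff_sums_eq flip, auto simp: adj_iff)
  next
    assume A: "int v dvd 2 * y - x"
    show thesis
      by (rule main[of y x z, OF _ A])
        (use sum_zero in simp, simp add: diff_sums_eq flip, auto simp: adj_iff)
  next
    assume A: "int v dvd 2 * z - x"
    show thesis
      by (rule main[of z x y, OF _ A])
        (use sum_zero in simp, simp add: diff_sums_eq flip, auto simp: adj_iff)
  next
    assume A: "int v dvd 2 * z - y"
    show thesis
      by (rule main[of z y x, OF _ A])
        (use sum_zero in simp, simp add: diff_sums_eq flip, auto simp: adj_iff)
  qed
qed

text \<open>Every step between collinear points is a multiple of \<open>s\<close>, so the points
  with index a multiple of \<open>s\<close> are closed under blocks. By connectedness they include
  \<open>p 1\<close>.\<close>

lemma unit_scale: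
  assumes cf: "symmetric_configuration_3 v V B" and conn: "connected_configuration_3 V B"
    and range: "range p = V"
    and adj: "\<And>u. adj u \<Longrightarrow> \<exists>k. int v dvd u - k * s"
  obtains r where "int v dvd 1 - s * r"
proof -
  let ?U = "range (\<lambda>i. p (s * i))"
  have "?U = V"
  proof (rule closed_set_eq_points[OF cf conn])
    show "?U \<subseteq> V" using range by blast
    fix \<beta> assume \<beta>: "\<beta> \<in> B" "\<beta> \<inter> ?U \<noteq> {}"
    then obtain i where i: "p (s * i) \<in> \<beta>" by blast
    show "\<beta> \<subseteq> ?U"
    proof
      fix q assume q: "q \<in> \<beta>"
      show "q \<in> ?U"
      proof (cases "q = p (s * i)")
        case False
        obtain j where j: "q = p j" using \<beta>(1) q unfolding blocks by blast
        have "collinear B (p (s * i)) (p j)"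
          unfolding collinear_def using False i q \<beta>(1) j by (intro conjI bexI[of _ \<beta>]) auto
        then obtain k where "int v dvd j - s * i - k * s" using adj unfolding collinear_iff by blast
        then have "p j = p (s * (i + k))" unfolding p_eq_iff by (simp add: algebra_simps)
        then show ?thesis unfolding j by blast
      qed blast
    qed
  qed simp
  then have "p 1 \<in> ?U" using range by blast
  then obtain r where "p 1 = p (s * r)" by blast
  then show ?thesis unfolding p_eq_iff by (rule that)
qed

text \<open>As \<open>s\<close> is a unit, \<open>adj (k * s)\<close> asks whether \<open>k\<close>
  is one of \<open>\<plusminus>1\<close>, \<open>\<plusminus>2\<close>, \<open>\<plusminus>3\<close>
  modulo \<open>v\<close>. The multipliers 1 and 2 always qualify; 4 does so only for
  \<open>v = 7\<close>, 5 for 7 and 8, and 6 for 7, 8 and 9.\<close>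

lemma diff_sums_doubling:
  assumes cf: "symmetric_configuration_3 v V B" and conn: "connected_configuration_3 V B"
    and range: "range p = V" and dbl: doubling and v7: "7 \<le> v"
  shows "diff_sums = (if v = 7 then 30 else if v = 8 then 24 else if v = 9 then 20 else 18)"
proof -
  obtain s where diff_sums: "diff_sums = 12 + 2 * (adj01 (2 * s) + adj01 (4 * s) + adj01 (6 * s)) + 4 * (adj01 s + adj01 (5 * s) + adj01 (4 * s))"
    and adj: "\<And>u. adj u \<longleftrightarrow> int v dvd u - s \<or> int v dvd u + s \<or> int v dvd u - 2 * s \<or> int v dvd u + 2 * s \<or>
      int v dvd u - 3 * s \<or> int v dvd u + 3 * s"
    using doubling_scale[OF dbl] by blast
  have ex: "\<exists>k. int v dvd u - k * s" if "adj u" for u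
    using that unfolding adj
    by (metis add_uminus_conv_diff diff_minus_eq_add mult_minus_left mult_1)
  obtain r where r: "int v dvd 1 - s * r"
    using unit_scale[OF cf conn range ex] by blast
  have cancel: "int v dvd k * s \<longleftrightarrow> int v dvd k" for k
  proof
    assume "int v dvd k * s"
    then show "int v dvd k"
      by (rule dvd_linear_combination[OF _ r, where m = r and n = k]) (simp add: algebra_simps)
  qed simp
  have Dk: "adj (k * s) \<longleftrightarrow> int v dvd k - 1 \<or> int v dvd k + 1 \<or> int v dvd k - 2 \<or> int v dvd k + 2 \<or>
      int v dvd k - 3 \<or> int v dvd k + 3" for k
  proof -
    have e: "k * s - s = (k - 1) * s" "k * s + s = (k + 1) * s" "k * s - 2 * s = (k - 2) * s"
      "k * s + 2 * s = (k + 2) * s" "k * s - 3 * s = (k - 3) * s" "k * s + 3 * s = (k + 3) * s"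
      by (simp_all add: algebra_simps)
    show ?thesis unfolding adj e cancel ..
  qed
  consider "v = 7" | "v = 8" | "v = 9" | "10 \<le> v" using v7 by linarith
  then show ?thesis
  proof cases
    case 4
    \<comment> \<open>The largest number tested is \<open>6 + 3 = 9\<close>, so the count is
      constant from \<open>v = 10\<close> on.\<close>
    have "\<not> int v dvd k" if "0 < k" "k < 10" for k
      using that 4 zdvd_imp_le[of "int v" k] by linarith
    then show ?thesis
      using 4 Dk[of 1] Dk[of 2] Dk[of 4] Dk[of 5] Dk[of 6] unfolding diff_sums by simp
  next
    case 1
    then show ?thesis
      using Dk[of 1] Dk[of 2] Dk[of 4] Dk[of 5] Dk[of 6] unfolding diff_sums by simp
  next
    case 2
    then show ?thesis
      using Dk[of 1] Dk[of 2] Dk[of 4] Dk[of 5] Dk[of 6] unfolding diff_sums by simp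
  next
    case 3
    then show ?thesis
      using Dk[of 1] Dk[of 2] Dk[of 4] Dk[of 5] Dk[of 6] unfolding diff_sums by simp
  qed
qed

end

section \<open>A starter block\<close>

text \<open>A block through \<open>p 0\<close> other than \<open>{0, v/3, 2v/3}\<close> has three
  distinct translates through \<open>p 0\<close>, which are all the blocks there since the degree is
  3. Hence every block is a translate of it, and linearity yields the incongruences of the
  locale.\<close>

lemma cyclic_configuration_starter:
  fixes V :: "'a set"
  assumes cf: "symmetric_configuration_3 v V B" and cyc: "cyclic_configuration V B"
  obtains p :: "int \<Rightarrow> 'a" and x y z where "cyclic_starter v p x y z B" "range p = V"
proof -
  have fin: "finite V" and cV: "card V = v" and B: "\<And>\<beta>. \<beta> \<in> B \<Longrightarrow> \<beta> \<subseteq> V \<and> card \<beta> = 3"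
    and deg: "\<And>a. a \<in> V \<Longrightarrow> card {\<beta> \<in> B. a \<in> \<beta>} = 3"
    using cf unfolding symmetric_configuration_3_def by auto
  obtain \<sigma> where \<sigma>: "\<sigma> permutes V" "(\<lambda>\<beta>. \<sigma> ` \<beta>) ` B = B" and c\<sigma>: "cyclic_on \<sigma> V"
    using cyc unfolding cyclic_configuration_def configuration_automorphism_def by blast
  obtain p where p_eq: "\<And>i j. p i = p j \<longleftrightarrow> int v dvd i - j" and range: "range p = V"
    and step: "\<And>i. \<sigma> (p i) = p (i + 1)"
    using cyclic_on_int_parametrization[OF fin \<sigma>(1) c\<sigma>] unfolding cV by metis
  have v_pos: "0 < v" using range cV fin by (metis UNIV_I card_gt_0_iff empty_iff image_eqI)
  note lin = configuration_linear[OF cf]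
  \<comment> \<open>Blocks are written as images of index sets, so that applying
    \<open>\<sigma>\<close> adds 1 to the indices. Negative translations follow because
    \<open>p\<close> depends on residues only.\<close>
  have shift_nat: "p ` ((\<lambda>i. i + int n) ` I) \<in> B" if "p ` I \<in> B" for n I
  proof (induction n)
    case 0
    then show ?case using that by simp
  next
    case (Suc n)
    have "\<sigma> ` (p ` ((\<lambda>i. i + int n) ` I)) \<in> B" using Suc \<sigma>(2) by blast
    then show ?case by (simp add: image_image step algebra_simps)
  qed
  have shift: "p ` ((\<lambda>i. i + n) ` I) \<in> B" if "p ` I \<in> B" for n :: int and I
  proof -
    have "p (i + n) = p (i + int (nat (n mod int v)))" for i
      unfolding p_eq using v_pos by (simp add: mod_eq_dvd_iff flip: mod_eq_dvd_iff)
    then show ?thesis using shift_nat[OF that, of "nat (n mod int v)"] by (simp add: image_image)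
  qed
  \<comment> \<open>A block does not determine its index set, so translation has to be shown to
    respect equality of images.\<close>
  have shift_eq: "p ` ((\<lambda>i. i + n) ` I) = p ` ((\<lambda>i. i + n) ` J)" if "p ` I = p ` J" for n I J
  proof -
    have "p ` ((\<lambda>i. i + n) ` I) \<subseteq> p ` ((\<lambda>i. i + n) ` J)" if sub: "p ` I \<subseteq> p ` J" for I J
    proof
      fix w assume "w \<in> p ` ((\<lambda>i. i + n) ` I)"
      then obtain i where i: "i \<in> I" "w = p (i + n)" by blast
      then obtain j where j: "j \<in> J" "p i = p j" using sub by blast
      then have "p (i + n) = p (j + n)" unfolding p_eq by simp
      then show "w \<in> p ` ((\<lambda>i. i + n) ` J)" using i j by blast
    qed
    then show ?thesis using that by (metis subset_antisym order_refl)
  qed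
  let ?S = "{\<beta> \<in> B. p 0 \<in> \<beta>}"
  have through0: "\<exists>a b. \<beta> = p ` {0, a, a + b}" if "\<beta> \<in> ?S" for \<beta>
  proof -
    have b: "\<beta> \<in> B" "p 0 \<in> \<beta>" using that by auto
    have "\<beta> \<noteq> {p 0}" using B[OF b(1)] by auto
    then obtain q where q: "q \<in> \<beta>" "q \<noteq> p 0" using b(2) by blast
    obtain r where r: "\<beta> = {p 0, q, r}"
      using card_3_third[of \<beta> "p 0" q] b q B[OF b(1)] by metis
    obtain a c where "q = p a" "r = p c" using r B[OF b(1)] unfolding range[symmetric] by blast
    then have "\<beta> = p ` {0, a, a + (c - a)}" using r by simp
    then show ?thesis by blast
  qed
  have V0: "p 0 \<in> V" using range by blast
  have triple: "\<not> int v dvd a" "\<not> int v dvd b" "\<not> int v dvd a + b" if "p ` {0, a, a + b} \<in> B" for a b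
  proof -
    have "card {p 0, p a, p (a + b)} = 3" using B[OF that] by simp
    then have "p a \<noteq> p 0" "p (a + b) \<noteq> p a" "p (a + b) \<noteq> p 0"
      by (auto simp: card_insert_if split: if_splits)
    then show "\<not> int v dvd a" "\<not> int v dvd b" "\<not> int v dvd a + b" by (simp_all add: p_eq)
  qed
  \<comment> \<open>Of the blocks through \<open>p 0\<close>, only \<open>{0, v/3, 2v/3}\<close> has fewer than three translates through \<open>p 0\<close>.\<close>
  have "\<exists>a b. p ` {0, a, a + b} \<in> B \<and> \<not> (int v dvd 3 * a \<and> int v dvd b - a)"
  proof (rule ccontr)
    assume bad: "\<not> ?thesis"
    obtain \<beta> \<gamma> \<delta> where "?S = {\<beta>, \<gamma>, \<delta>}" and ne: "\<beta> \<noteq> \<gamma>"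
      using deg[OF V0] by (metis card_3_iff)
    then have \<beta>: "\<beta> \<in> ?S" and \<gamma>: "\<gamma> \<in> ?S" by blast+
    obtain a b where ab: "\<beta> = p ` {0, a, a + b}" using through0[OF \<beta>] by blast
    obtain c d where cd: "\<gamma> = p ` {0, c, c + d}" using through0[OF \<gamma>] by blast
    have a: "int v dvd 3 * a" "int v dvd b - a" "\<not> int v dvd a"
      using bad \<beta> triple unfolding ab by blast+
    have c: "int v dvd 3 * c" "int v dvd d - c" "\<not> int v dvd c"
      using bad \<gamma> triple unfolding cd by blast+
    \<comment> \<open>\<open>c\<close> is congruent to \<open>a\<close> or \<open>- a\<close>, and
      \<open>- a\<close> to \<open>a + b\<close>, because \<open>b\<close> is congruent to
      \<open>a\<close> and \<open>3 * a\<close> to 0. The two blocks thus share a second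
      point.\<close>
    have "p c \<in> \<beta>"
      using dvd_triple_cases[OF _ a(1) c(1) a(3) c(3)]
    proof
      assume "int v dvd c + a"
      moreover have "c - (a + b) = (c + a) - 3 * a - (b - a)" by simp
      ultimately have "p c = p (a + b)" unfolding p_eq using a by (metis dvd_diff)
      then show ?thesis unfolding ab by simp
    next
      assume "int v dvd c - a"
      then have "p c = p a" unfolding p_eq .
      then show ?thesis unfolding ab by simp
    qed (use v_pos in simp)
    moreover have "p c \<in> \<gamma>" "p 0 \<noteq> p c" using cd c(3) p_eq[of c 0] by auto
    ultimately show False using lin[of \<beta> \<gamma> "p 0" "p c"] \<beta> \<gamma> ne by blast
  qed
  then obtain a b where \<beta>1: "p ` {0, a, a + b} \<in> B"
    and good: "\<not> (int v dvd 3 * a \<and> int v dvd b - a)" by blast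
  note nz = triple[OF \<beta>1]
  \<comment> \<open>The translates by \<open>0\<close>, \<open>- a\<close> and
    \<open>- a - b\<close>, each moving one point of the block to \<open>p 0\<close>.\<close>
  define \<beta>1 where "\<beta>1 = {p 0, p a, p (a + b)}"
  define \<beta>2 where "\<beta>2 = {p 0, p b, p (- a)}"
  define \<beta>3 where "\<beta>3 = {p 0, p (- a - b), p (- b)}"
  have b1: "\<beta>1 \<in> B" using \<beta>1 unfolding \<beta>1_def by simp
  have b2: "\<beta>2 \<in> B" using shift[OF \<beta>1, of "- a"] unfolding \<beta>2_def by (simp add: insert_commute)
  have b3: "\<beta>3 \<in> B" using shift[OF \<beta>1, of "- a - b"] unfolding \<beta>3_def by (simp add: insert_commute)
  have good': "\<not> (int v dvd 2 * a + b \<and> int v dvd b - a)"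
  proof
    assume A: "int v dvd 2 * a + b \<and> int v dvd b - a"
    have "3 * a = (2 * a + b) - (b - a)" by simp
    then have "int v dvd 3 * a" using A by (metis dvd_diff)
    then show False using A good by simp
  qed
  have nm: "\<not> int v dvd - a - b" "\<not> int v dvd - b - a"
  proof -
    have e: "- a - b = - (a + b)" "- b - a = - (a + b)" by simp_all
    show "\<not> int v dvd - a - b" "\<not> int v dvd - b - a"
      unfolding e dvd_minus_iff by (fact nz(3))+
  qed
  \<comment> \<open>Here and in the next two comparisons the remaining points can match in two ways:
    one makes \<open>a\<close> or \<open>a + b\<close> vanish, the other makes both
    \<open>b - a\<close> and \<open>2 * a + b\<close> vanish, against \<open>good'\<close>.\<close>
  have n12: "\<beta>1 \<noteq> \<beta>2"
  proof
    assume "\<beta>1 = \<beta>2"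
    then have "p b \<in> \<beta>1" "p (- a) \<in> \<beta>1" unfolding \<beta>2_def by auto
    then have ba: "int v dvd b - a" and "int v dvd - a - a \<or> int v dvd - a - (a + b)"
      using nz unfolding \<beta>1_def by (auto simp: p_eq)
    then show False
    proof (elim disjE)
      assume "int v dvd - a - a"
      then have "int v dvd a + b"
        by (rule dvd_linear_combination[OF ba, where m = 1 and n = "- 1"]) simp
      then show False using nz by simp
    next
      assume "int v dvd - a - (a + b)"
      then have "int v dvd 2 * a + b"
        by (rule dvd_linear_combination[OF ba, where m = 0 and n = "- 1"]) simp
      then show False using good' ba by simp
    qed
  qed
  have n13: "\<beta>1 \<noteq> \<beta>3"
  proof
    assume "\<beta>1 = \<beta>3"
    then have "p (- b) \<in> \<beta>1" "p (- a - b) \<in> \<beta>1" unfolding \<beta>3_def by auto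
    then have ab: "int v dvd - b - (a + b)" and "int v dvd - a - b - a \<or> int v dvd - a - b - (a + b)"
      using nz nm unfolding \<beta>1_def by (auto simp: p_eq)
    then show False
    proof (elim disjE)
      assume d: "int v dvd - a - b - a"
      then have "int v dvd 2 * a + b"
        by (rule dvd_linear_combination[OF ab, where m = 0 and n = "- 1"]) simp
      moreover have "int v dvd b - a"
        by (rule dvd_linear_combination[OF ab d, where m = "- 1" and n = 1]) simp
      ultimately show False using good' by simp
    next
      assume "int v dvd - a - b - (a + b)"
      then have "int v dvd a"
        by (rule dvd_linear_combination[OF ab, where m = 1 and n = "- 1"]) simp
      then show False using nz by simp
    qed
  qed
  have n23: "\<beta>2 \<noteq> \<beta>3"
  proof
    assume "\<beta>2 = \<beta>3"
    then have "p b \<in> \<beta>3" "p (- a) \<in> \<beta>3" unfolding \<beta>2_def by auto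
    then have ab: "int v dvd - a - - b" and "int v dvd b - (- a - b) \<or> int v dvd b - - b"
      using nz nm unfolding \<beta>3_def by (auto simp: p_eq)
    then show False
    proof (elim disjE)
      assume d: "int v dvd b - (- a - b)"
      then have "int v dvd 2 * a + b"
        by (rule dvd_linear_combination[OF ab, where m = "- 1" and n = 1]) simp
      moreover have "int v dvd b - a"
        by (rule dvd_linear_combination[OF ab d, where m = 1 and n = 0]) simp
      ultimately show False using good' by simp
    next
      assume "int v dvd b - - b"
      then have "int v dvd a + b"
        by (rule dvd_linear_combination[OF ab, where m = "- 1" and n = 1]) simp
      then show False using nz by simp
    qed
  qed
  have S: "?S = {\<beta>1, \<beta>2, \<beta>3}"
  proof (rule card_seteq[symmetric])
    show "finite ?S" by (rule card_ge_0_finite) (simp only: deg[OF V0] zero_less_numeral)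
    have "p 0 \<in> \<beta>1" "p 0 \<in> \<beta>2" "p 0 \<in> \<beta>3" unfolding \<beta>1_def \<beta>2_def \<beta>3_def by simp_all
    then show "{\<beta>1, \<beta>2, \<beta>3} \<subseteq> ?S" using b1 b2 b3 by simp
    have "card {\<beta>1, \<beta>2, \<beta>3} = 3" using n12 n13 n23 by simp
    then show "card ?S \<le> card {\<beta>1, \<beta>2, \<beta>3}" by (simp only: deg[OF V0] order_refl)
  qed
  let ?blk = "\<lambda>i. {p i, p (i + a), p (i + a + b)}"
  have nz': "p a \<noteq> p 0" "p b \<noteq> p 0" "p (a + b) \<noteq> p 0" using nz by (simp_all add: p_eq)
  \<comment> \<open>Distinct blocks through \<open>p 0\<close> meet nowhere else. The resulting
    inequalities between points are the locale conditions on doubles and differences for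
    \<open>z = - a - b\<close>.\<close>
  have m12: "w = p 0" if "w \<in> \<beta>1" "w \<in> \<beta>2" for w
    using lin[OF b1 b2, of w "p 0"] n12 that unfolding \<beta>1_def \<beta>2_def by blast
  have m13: "w = p 0" if "w \<in> \<beta>1" "w \<in> \<beta>3" for w
    using lin[OF b1 b3, of w "p 0"] n13 that unfolding \<beta>1_def \<beta>3_def by blast
  have m23: "w = p 0" if "w \<in> \<beta>2" "w \<in> \<beta>3" for w
    using lin[OF b2 b3, of w "p 0"] n23 that unfolding \<beta>2_def \<beta>3_def by blast
  have d: "p a \<noteq> p (- a)" "p a \<noteq> p b" "p (a + b) \<noteq> p (- a - b)" "p a \<noteq> p (- a - b)"
    "p b \<noteq> p (- b)" "p b \<noteq> p (- a - b)"
    using m12[of "p a"] m13[of "p (a + b)"] m13[of "p a"] m23[of "p b"] nz'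
    unfolding \<beta>1_def \<beta>2_def \<beta>3_def by auto
  have Bsub: "\<gamma> \<in> range ?blk" if "\<gamma> \<in> B" for \<gamma>
  proof -
    have "\<gamma> \<subseteq> p ` UNIV" "\<gamma> \<noteq> {}" using B[OF that] range by auto
    then obtain I where I: "\<gamma> = p ` I" "I \<noteq> {}" by (metis subset_image_iff image_empty)
    \<comment> \<open>Translating by \<open>- i\<close> moves a point of the block to
      \<open>p 0\<close>, where only the translates starting at \<open>0\<close>, \<open>- a\<close>
      and \<open>- a - b\<close> occur; translating back gives the claim.\<close>
    then obtain i where i: "i \<in> I" by blast
    have "p ` ((\<lambda>k. k + (- i)) ` I) \<in> ?S"
      using shift[of I "- i"] that i unfolding I(1) by (auto simp: image_image intro!: image_eqI[of _ _ i])
    then have "\<exists>n. p ` ((\<lambda>k. k + (- i)) ` I) = p ` {n, n + a, n + a + b}"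
      unfolding S \<beta>1_def \<beta>2_def \<beta>3_def
      by (elim insertE emptyE)
        (rule exI[of _ 0] exI[of _ "- a"] exI[of _ "- a - b"]; simp add: insert_commute; fail)+
    then obtain n where "p ` ((\<lambda>k. k + (- i)) ` I) = p ` {n, n + a, n + a + b}" by blast
    from shift_eq[OF this, of i] have "\<gamma> = ?blk (n + i)"
      unfolding I(1) by (simp add: image_image algebra_simps)
    then show ?thesis by blast
  qed
  have "?blk i \<in> B" for i
    using shift[OF \<beta>1, of i] by (simp add: algebra_simps)
  then have rangeB: "B = range ?blk" using Bsub by blast
  have e: "2 * a = a - - a" "2 * b = b - - b" "- (2 * (- a - b)) = a + b - (- a - b)"
    "- (- a - b - a) = a - (- a - b)" by simp_all
  have "\<not> int v dvd 2 * a" unfolding e using d by (simp only: p_eq) simp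
  moreover have "\<not> int v dvd 2 * b" unfolding e using d by (simp only: p_eq) simp
  moreover have "\<not> int v dvd - (2 * (- a - b))" unfolding e using d by (simp only: p_eq) simp
  moreover have "\<not> int v dvd b - (- a - b)" using d by (simp only: p_eq) simp
  moreover have "\<not> int v dvd a - b" using d by (simp only: p_eq) simp
  moreover have "\<not> int v dvd - (- a - b - a)" unfolding e using d by (simp only: p_eq) simp
  ultimately have "cyclic_starter v p a b (- a - b) B"
    unfolding cyclic_starter_def dvd_minus_iff
    using v_pos p_eq nz(1,2) nm(1) rangeB by (intro conjI allI) simp_all
  then show ?thesis using range by (rule that)
qed

section \<open>The number of triangles\<close>

theorem theorem4p1:
  fixes v :: nat and V :: "'a set" and B :: "'a set set"
  assumes "symmetric_configuration_3 v V B"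
    and "connected_configuration_3 V B"
    and "cyclic_configuration V B"
  shows "(v = 7 \<longrightarrow> real (card (triangles B)) = 4 * real v) \<and>
         (v = 8 \<longrightarrow> real (card (triangles B)) = 3 * real v) \<and>
         (v = 9 \<longrightarrow> real (card (triangles B)) = 7 * real v / 3) \<and>
         (v \<ge> 10 \<longrightarrow> real (card (triangles B)) \<in> {real v, 4 * real v / 3, 2 * real v})"
proof (cases "7 \<le> v")
  case True
  obtain p :: "int \<Rightarrow> 'a" and x y z where st: "cyclic_starter v p x y z B" and range: "range p = V"
    using cyclic_configuration_starter[OF assms(1,3)] by blast
  interpret cyclic_starter v p x y z B by (fact st)
  have "6 * (card (triangles B) + v) = v * diff_sums"
    using card_cliques_3 card_triangles[OF assms(1)] unfolding diff_sums_def by simp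
  then have "6 * (real (card (triangles B)) + real v) = real v * real diff_sums"
    by (metis of_nat_add of_nat_mult of_nat_numeral)
  then have T: "real (card (triangles B)) = real v * real diff_sums / 6 - real v" by simp
  show ?thesis
  proof (cases doubling)
    case dbl: True
    \<comment> \<open>The values 30, 24, 20 and 18 of \<open>diff_sums\<close> become
      \<open>4 v\<close>, \<open>3 v\<close>, \<open>7 v / 3\<close> and \<open>2 v\<close>.\<close>
    show ?thesis
      using diff_sums_doubling[OF assms(1,2) range dbl True] unfolding T by (auto split: if_splits)
  next
    case False
    then have "v \<notin> {7, 8, 9}" using doubling_small by blast
    then show ?thesis
      using diff_sums_not_doubling[OF False] unfolding T by auto
  qed
\<comment> \<open>For \<open>v < 7\<close> all four implications are vacuous.\<close>
qed auto

end
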